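(* Let $\mathcal A,\mathcal B,\mathcal C,\mathcal D$ be abelian categories and consider three right wide Morita contexts: $\Gamma$ between $\mathcal A$ and $\mathcal B$, $\Delta$ between $\mathcal B$ and $\mathcal C$, and $\Sigma$ between $\mathcal C$ and $\mathcal D$. Then $(\Gamma\circ\Delta)\circ\Sigma=\Gamma\circ(\Delta\circ\Sigma)$.
   Context: All functors are additive. A right wide Morita context between abelian categories $\mathcal A$ and $\mathcal B$ is a datum $(F,G,\eta,\rho)$ where $F:\mathcal B\to\mathcal A$ and $G:\mathcal A\to\mathcal B$ are right exact functors and $\eta:F\circ G\to 1_{\mathcal A}$, $\rho:G\circ F\to 1_{\mathcal B}$ are natural transformations with $G\eta=\rho G$ and $F\rho=\eta F$. Composition: if $\Gamma=(F,G,\eta,\rho)$ is a right wide Morita context between $\mathcal A$ and $\mathcal B$ and $\Delta=(U,V,\epsilon,\delta)$ one between $\mathcal B$ and $\mathcal C$, then $\Gamma\circ\Delta$ is the right wide Morita context $(F\circ U,V\circ G,\gamma,\pi)$ between $\mathcal A$ and $\mathcal C$, where $\gamma(X)=\eta(X)\circ F(\epsilon(G(X)))$ for $X\in\mathcal A$ and $\pi(Z)=\delta(Z)\circ V(\rho(U(Z)))$ for $Z\in\mathcal C$. *)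

theory Defs
  imports "HOL-Algebra.Group" "HOL-Library.FuncSet"
begin

section \<open>Abelian categories\<close>

text \<open>Arrows determine their source and target. All fields are meaningful only on the carriers
  \<open>obs\<close> and \<open>arrs\<close>; \<open>cmp C g f\<close> is "g after f" and is meaningful only if
  \<open>src C g = tgt C f\<close>, \<open>add_arr C f g\<close> only for parallel arrows.\<close>

record ('o, 'm) cat =
  obs :: "'o set"
  arrs :: "'m set"
  src :: "'m \<Rightarrow> 'o"
  tgt :: "'m \<Rightarrow> 'o"
  ident :: "'o \<Rightarrow> 'm"
  cmp :: "'m \<Rightarrow> 'm \<Rightarrow> 'm"
  add_arr :: "'m \<Rightarrow> 'm \<Rightarrow> 'm"
  zero_arr :: "'o \<Rightarrow> 'o \<Rightarrow> 'm"

definition Hom :: "('o, 'm) cat \<Rightarrow> 'o \<Rightarrow> 'o \<Rightarrow> 'm set" where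
  "Hom C X Y = {f \<in> arrs C. src C f = X \<and> tgt C f = Y}"

definition Hom_group :: "('o, 'm) cat \<Rightarrow> 'o \<Rightarrow> 'o \<Rightarrow> 'm monoid" where
  "Hom_group C X Y = \<lparr>carrier = Hom C X Y, mult = add_arr C, one = zero_arr C X Y\<rparr>"

locale category =
  fixes C :: "('o, 'm) cat"
  assumes src_in: "f \<in> arrs C \<Longrightarrow> src C f \<in> obs C"
    and tgt_in: "f \<in> arrs C \<Longrightarrow> tgt C f \<in> obs C"
    and ident_in: "X \<in> obs C \<Longrightarrow> ident C X \<in> Hom C X X"
    and comp_in: "f \<in> Hom C X Y \<Longrightarrow> g \<in> Hom C Y Z \<Longrightarrow> cmp C g f \<in> Hom C X Z"
    and comp_ident_right: "f \<in> Hom C X Y \<Longrightarrow> cmp C f (ident C X) = f"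
    and comp_ident_left: "f \<in> Hom C X Y \<Longrightarrow> cmp C (ident C Y) f = f"
    and comp_assoc: "f \<in> Hom C W X \<Longrightarrow> g \<in> Hom C X Y \<Longrightarrow> h \<in> Hom C Y Z \<Longrightarrow>
      cmp C h (cmp C g f) = cmp C (cmp C h g) f"

locale preadditive_category = category C for C :: "('o, 'm) cat" +
  assumes Hom_comm_group: "X \<in> obs C \<Longrightarrow> Y \<in> obs C \<Longrightarrow> comm_group (Hom_group C X Y)"
    and comp_plus_right: "f \<in> Hom C X Y \<Longrightarrow> f' \<in> Hom C X Y \<Longrightarrow> g \<in> Hom C Y Z \<Longrightarrow>
      cmp C g (add_arr C f f') = add_arr C (cmp C g f) (cmp C g f')"
    and comp_plus_left: "f \<in> Hom C X Y \<Longrightarrow> g \<in> Hom C Y Z \<Longrightarrow> g' \<in> Hom C Y Z \<Longrightarrow>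
      cmp C (add_arr C g g') f = add_arr C (cmp C g f) (cmp C g' f)"

definition zero_object :: "('o, 'm) cat \<Rightarrow> 'o \<Rightarrow> bool" where
  "zero_object C N \<longleftrightarrow> N \<in> obs C \<and>
     (\<forall>X\<in>obs C. (\<exists>!f. f \<in> Hom C X N) \<and> (\<exists>!f. f \<in> Hom C N X))"

definition monic :: "('o, 'm) cat \<Rightarrow> 'm \<Rightarrow> bool" where
  "monic C f \<longleftrightarrow> f \<in> arrs C \<and>
     (\<forall>W. \<forall>g\<in>Hom C W (src C f). \<forall>h\<in>Hom C W (src C f). cmp C f g = cmp C f h \<longrightarrow> g = h)"

definition epic :: "('o, 'm) cat \<Rightarrow> 'm \<Rightarrow> bool" where
  "epic C f \<longleftrightarrow> f \<in> arrs C \<and>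
     (\<forall>Z. \<forall>g\<in>Hom C (tgt C f) Z. \<forall>h\<in>Hom C (tgt C f) Z. cmp C g f = cmp C h f \<longrightarrow> g = h)"

definition kernel_of :: "('o, 'm) cat \<Rightarrow> 'm \<Rightarrow> 'm \<Rightarrow> bool" where
  "kernel_of C k f \<longleftrightarrow> f \<in> arrs C \<and> k \<in> arrs C \<and> tgt C k = src C f \<and>
     cmp C f k = zero_arr C (src C k) (tgt C f) \<and>
     (\<forall>W. \<forall>h\<in>Hom C W (src C f). cmp C f h = zero_arr C W (tgt C f) \<longrightarrow>
        (\<exists>!u. u \<in> Hom C W (src C k) \<and> cmp C k u = h))"

definition cokernel_of :: "('o, 'm) cat \<Rightarrow> 'm \<Rightarrow> 'm \<Rightarrow> bool" where
  "cokernel_of C c f \<longleftrightarrow> f \<in> arrs C \<and> c \<in> arrs C \<and> src C c = tgt C f \<and>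
     cmp C c f = zero_arr C (src C f) (tgt C c) \<and>
     (\<forall>Z. \<forall>h\<in>Hom C (tgt C f) Z. cmp C h f = zero_arr C (src C f) Z \<longrightarrow>
        (\<exists>!u. u \<in> Hom C (tgt C c) Z \<and> cmp C u c = h))"

definition biproduct_of :: "('o, 'm) cat \<Rightarrow> 'o \<Rightarrow> 'o \<Rightarrow> 'o \<Rightarrow> 'm \<Rightarrow> 'm \<Rightarrow> 'm \<Rightarrow> 'm \<Rightarrow> bool" where
  "biproduct_of C X Y P i j p q \<longleftrightarrow> P \<in> obs C \<and>
     i \<in> Hom C X P \<and> j \<in> Hom C Y P \<and> p \<in> Hom C P X \<and> q \<in> Hom C P Y \<and>
     cmp C p i = ident C X \<and> cmp C q j = ident C Y \<and>
     add_arr C (cmp C i p) (cmp C j q) = ident C P"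

locale abelian_category = preadditive_category C for C :: "('o, 'm) cat" +
  assumes ex_zero_object: "\<exists>N. zero_object C N"
    and ex_biproduct: "X \<in> obs C \<Longrightarrow> Y \<in> obs C \<Longrightarrow> \<exists>P i j p q. biproduct_of C X Y P i j p q"
    and ex_kernel: "f \<in> arrs C \<Longrightarrow> \<exists>k. kernel_of C k f"
    and ex_cokernel: "f \<in> arrs C \<Longrightarrow> \<exists>c. cokernel_of C c f"
    and monic_is_kernel: "monic C f \<Longrightarrow> \<exists>g. kernel_of C f g"
    and epic_is_cokernel: "epic C f \<Longrightarrow> \<exists>g. cokernel_of C f g"

text \<open>The image of an arrow is the kernel of its cokernel. A sequence of two arrows is exact if
  the image of the first is the kernel of the second, as subobjects of the middle object.\<close>

definition image_of :: "('o, 'm) cat \<Rightarrow> 'm \<Rightarrow> 'm \<Rightarrow> bool" where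
  "image_of C i f \<longleftrightarrow> (\<exists>c. cokernel_of C c f \<and> kernel_of C i c)"

definition exact_at :: "('o, 'm) cat \<Rightarrow> 'm \<Rightarrow> 'm \<Rightarrow> bool" where
  "exact_at C f g \<longleftrightarrow> (\<exists>i. image_of C i f \<and> kernel_of C i g)"

text \<open>Exactness of \<open>X \<rightarrow> Y \<rightarrow> Z \<rightarrow> 0\<close>.\<close>

definition right_exact_sequence :: "('o, 'm) cat \<Rightarrow> 'm \<Rightarrow> 'm \<Rightarrow> bool" where
  "right_exact_sequence C f g \<longleftrightarrow>
     exact_at C f g \<and> (\<exists>N. zero_object C N \<and> exact_at C g (zero_arr C (tgt C g) N))"


section \<open>Functors and natural transformations\<close>

text \<open>Functors and natural transformations are required to be \<^const>\<open>extensional\<close>,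
  so that two of them are equal in HOL iff they agree on all objects and arrows of the
  source category.\<close>

record ('o1, 'm1, 'o2, 'm2) funct =
  on_obs :: "'o1 \<Rightarrow> 'o2"
  on_arrs :: "'m1 \<Rightarrow> 'm2"

locale additive_functor =
  S: abelian_category S + T: abelian_category T
  for S :: "('o1, 'm1) cat" and T :: "('o2, 'm2) cat" +
  fixes F :: "('o1, 'm1, 'o2, 'm2) funct"
  assumes on_obs_ext: "on_obs F \<in> extensional (obs S)"
    and on_arrs_ext: "on_arrs F \<in> extensional (arrs S)"
    and on_obs_in: "X \<in> obs S \<Longrightarrow> on_obs F X \<in> obs T"
    and on_arrs_ident: "X \<in> obs S \<Longrightarrow> on_arrs F (ident S X) = ident T (on_obs F X)"
    and on_arrs_comp: "f \<in> Hom S X Y \<Longrightarrow> g \<in> Hom S Y Z \<Longrightarrow>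
      on_arrs F (cmp S g f) = cmp T (on_arrs F g) (on_arrs F f)"
    and on_arrs_hom: "X \<in> obs S \<Longrightarrow> Y \<in> obs S \<Longrightarrow>
      on_arrs F \<in> hom (Hom_group S X Y) (Hom_group T (on_obs F X) (on_obs F Y))"

locale right_exact_functor = additive_functor S T F
  for S :: "('o1, 'm1) cat" and T :: "('o2, 'm2) cat" and F :: "('o1, 'm1, 'o2, 'm2) funct" +
  assumes preserves_right_exact:
    "right_exact_sequence S f g \<Longrightarrow> right_exact_sequence T (on_arrs F f) (on_arrs F g)"

definition id_funct :: "('o, 'm) cat \<Rightarrow> ('o, 'm, 'o, 'm) funct" where
  "id_funct S = \<lparr>on_obs = (\<lambda>X\<in>obs S. X), on_arrs = (\<lambda>f\<in>arrs S. f)\<rparr>"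

text \<open>\<open>comp_funct S F U\<close> is \<open>F \<circ> U\<close>, where \<open>S\<close> is the source category of \<open>U\<close>.\<close>

definition comp_funct :: "('o1, 'm1) cat \<Rightarrow> ('o2, 'm2, 'o3, 'm3) funct \<Rightarrow>
    ('o1, 'm1, 'o2, 'm2) funct \<Rightarrow> ('o1, 'm1, 'o3, 'm3) funct" where
  "comp_funct S F U =
     \<lparr>on_obs = compose (obs S) (on_obs F) (on_obs U),
      on_arrs = compose (arrs S) (on_arrs F) (on_arrs U)\<rparr>"

definition nat_trans :: "('o1, 'm1) cat \<Rightarrow> ('o2, 'm2) cat \<Rightarrow> ('o1, 'm1, 'o2, 'm2) funct \<Rightarrow>
    ('o1, 'm1, 'o2, 'm2) funct \<Rightarrow> ('o1 \<Rightarrow> 'm2) \<Rightarrow> bool" where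
  "nat_trans S T F G \<alpha> \<longleftrightarrow> \<alpha> \<in> extensional (obs S) \<and>
     (\<forall>X\<in>obs S. \<alpha> X \<in> Hom T (on_obs F X) (on_obs G X)) \<and>
     (\<forall>X Y. \<forall>f\<in>Hom S X Y. cmp T (\<alpha> Y) (on_arrs F f) = cmp T (on_arrs G f) (\<alpha> X))"


section \<open>Right wide Morita contexts\<close>

record ('oa, 'ma, 'ob, 'mb) wide_context =
  ctx_F :: "('ob, 'mb, 'oa, 'ma) funct"
  ctx_G :: "('oa, 'ma, 'ob, 'mb) funct"
  ctx_eta :: "'oa \<Rightarrow> 'ma"
  ctx_rho :: "'ob \<Rightarrow> 'mb"

locale right_wide_morita_context =
  A: abelian_category A + B: abelian_category B
  for A :: "('oa, 'ma) cat" and B :: "('ob, 'mb) cat" +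
  fixes \<Gamma> :: "('oa, 'ma, 'ob, 'mb) wide_context"
  assumes F_right_exact: "right_exact_functor B A (ctx_F \<Gamma>)"
    and G_right_exact: "right_exact_functor A B (ctx_G \<Gamma>)"
    and eta_nat: "nat_trans A A (comp_funct A (ctx_F \<Gamma>) (ctx_G \<Gamma>)) (id_funct A) (ctx_eta \<Gamma>)"
    and rho_nat: "nat_trans B B (comp_funct B (ctx_G \<Gamma>) (ctx_F \<Gamma>)) (id_funct B) (ctx_rho \<Gamma>)"
    and G_eta: "X \<in> obs A \<Longrightarrow>
      on_arrs (ctx_G \<Gamma>) (ctx_eta \<Gamma> X) = ctx_rho \<Gamma> (on_obs (ctx_G \<Gamma>) X)"
    and F_rho: "Y \<in> obs B \<Longrightarrow>
      on_arrs (ctx_F \<Gamma>) (ctx_rho \<Gamma> Y) = ctx_eta \<Gamma> (on_obs (ctx_F \<Gamma>) Y)"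

text \<open>\<open>comp_ctx A C \<Gamma> \<Delta>\<close> is \<open>\<Gamma> \<circ> \<Delta>\<close> for \<open>\<Gamma>\<close> between \<open>A\<close> and \<open>B\<close> and \<open>\<Delta>\<close> between \<open>B\<close> and \<open>C\<close>;
  the outer categories are arguments because they supply the composition of arrows and the
  sets to which functors and natural transformations are restricted.\<close>

definition comp_ctx :: "('oa, 'ma) cat \<Rightarrow> ('oc, 'mc) cat \<Rightarrow>
    ('oa, 'ma, 'ob, 'mb) wide_context \<Rightarrow> ('ob, 'mb, 'oc, 'mc) wide_context \<Rightarrow>
    ('oa, 'ma, 'oc, 'mc) wide_context" where
  "comp_ctx A C \<Gamma> \<Delta> =
     \<lparr>ctx_F = comp_funct C (ctx_F \<Gamma>) (ctx_F \<Delta>),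
      ctx_G = comp_funct A (ctx_G \<Delta>) (ctx_G \<Gamma>),
      ctx_eta = (\<lambda>X\<in>obs A.
        cmp A (ctx_eta \<Gamma> X) (on_arrs (ctx_F \<Gamma>) (ctx_eta \<Delta> (on_obs (ctx_G \<Gamma>) X)))),
      ctx_rho = (\<lambda>Z\<in>obs C.
        cmp C (ctx_rho \<Delta> Z) (on_arrs (ctx_G \<Delta>) (ctx_rho \<Gamma> (on_obs (ctx_F \<Delta>) Z))))\<rparr>"

lemma Hom_obs:
  assumes "category C" "f \<in> Hom C X Y"
  shows "X \<in> obs C" "Y \<in> obs C" "f \<in> arrs C"
  using assms category.src_in[of C f] category.tgt_in[of C f] by (auto simp: Hom_def)

lemma additive_functor_Hom:
  assumes "additive_functor S T F" "f \<in> Hom S X Y"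
  shows "on_arrs F f \<in> Hom T (on_obs F X) (on_obs F Y)"
proof -
  interpret additive_functor S T F by fact
  have "X \<in> obs S" "Y \<in> obs S"
    using Hom_obs[OF S.category_axioms assms(2)] by auto
  from on_arrs_hom[OF this] assms(2) show ?thesis
    by (auto simp: hom_def Hom_group_def)
qed

lemma right_exact_sequence_arrs:
  assumes "right_exact_sequence S f g"
  shows "f \<in> arrs S" "g \<in> arrs S"
  using assms
  by (auto simp: right_exact_sequence_def exact_at_def image_of_def cokernel_of_def kernel_of_def)

lemma right_exact_comp_funct:
  assumes "right_exact_functor R S U" "right_exact_functor S T F"
  shows "right_exact_functor R T (comp_funct R F U)"
proof -
  interpret U: right_exact_functor R S U by fact
  interpret F: right_exact_functor S T F by fact
  have H: "f \<in> arrs R" "X \<in> obs R" "Y \<in> obs R" if "f \<in> Hom R X Y" for f X Y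
    using Hom_obs[OF U.S.category_axioms that] by auto
  have UH: "on_arrs U f \<in> Hom S (on_obs U X) (on_obs U Y)" if "f \<in> Hom R X Y" for f X Y
    using additive_functor_Hom[OF U.additive_functor_axioms that] .
  show ?thesis
  proof unfold_locales
    fix X assume X: "X \<in> obs R"
    have "ident R X \<in> arrs R" using H(1)[OF U.S.ident_in[OF X]] .
    then show "on_arrs (comp_funct R F U) (ident R X) = ident T (on_obs (comp_funct R F U) X)"
      using X by (simp add: comp_funct_def compose_def U.on_obs_in U.on_arrs_ident F.on_arrs_ident)
  next
    fix f g X Y Z assume f: "f \<in> Hom R X Y" and g: "g \<in> Hom R Y Z"
    have "cmp R g f \<in> arrs R" using H(1)[OF U.S.comp_in[OF f g]] .
    then show "on_arrs (comp_funct R F U) (cmp R g f) =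
        cmp T (on_arrs (comp_funct R F U) g) (on_arrs (comp_funct R F U) f)"
      using H(1)[OF f] H(1)[OF g] U.on_arrs_comp[OF f g] F.on_arrs_comp[OF UH[OF f] UH[OF g]]
      by (simp add: comp_funct_def compose_def)
  next
    fix X Y assume X: "X \<in> obs R" and Y: "Y \<in> obs R"
    let ?G = "Hom_group R X Y"
    have "comm_group ?G" using U.S.Hom_comm_group[OF X Y] .
    then interpret G: comm_group ?G .
    have U: "on_arrs U \<in> hom ?G (Hom_group S (on_obs U X) (on_obs U Y))"
      by (rule U.on_arrs_hom[OF X Y])
    have F: "on_arrs F \<in> hom (Hom_group S (on_obs U X) (on_obs U Y))
        (Hom_group T (on_obs F (on_obs U X)) (on_obs F (on_obs U Y)))"
      by (rule F.on_arrs_hom[OF U.on_obs_in[OF X] U.on_obs_in[OF Y]])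
    have c: "carrier ?G \<subseteq> arrs R" by (auto simp: Hom_group_def Hom_def)
    have "on_arrs (comp_funct R F U) f = (on_arrs F \<circ> on_arrs U) f" if "f \<in> carrier ?G" for f
      using that c by (auto simp: comp_funct_def compose_def)
    moreover have "on_arrs F \<circ> on_arrs U \<in> hom ?G
        (Hom_group T (on_obs F (on_obs U X)) (on_obs F (on_obs U Y)))"
      using U F by (rule hom_compose)
    moreover have "on_obs F (on_obs U X) = on_obs (comp_funct R F U) X"
      "on_obs F (on_obs U Y) = on_obs (comp_funct R F U) Y"
      using X Y by (simp_all add: comp_funct_def compose_def)
    ultimately show "on_arrs (comp_funct R F U) \<in> hom ?G
        (Hom_group T (on_obs (comp_funct R F U) X) (on_obs (comp_funct R F U) Y))"
      by (simp add: hom_def Pi_iff)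
  next
    fix f g assume "right_exact_sequence R f g"
    then show "right_exact_sequence T (on_arrs (comp_funct R F U) f) (on_arrs (comp_funct R F U) g)"
      using right_exact_sequence_arrs[of R f g]
      by (simp add: comp_funct_def compose_def U.preserves_right_exact F.preserves_right_exact)
  qed (auto simp: comp_funct_def compose_def U.on_obs_in F.on_obs_in)
qed

text \<open>The natural transformation \<open>\<eta> \<circ> F \<epsilon> G\<close>, used for both components of a composite.\<close>

lemma nat_trans_sandwich:
  assumes F: "additive_functor B A F" and G: "additive_functor A B G"
    and U: "additive_functor C B U" and V: "additive_functor B C V"
    and \<eta>: "nat_trans A A (comp_funct A F G) (id_funct A) \<eta>"
    and \<epsilon>: "nat_trans B B (comp_funct B U V) (id_funct B) \<epsilon>"
  shows "nat_trans A A (comp_funct A (comp_funct C F U) (comp_funct A V G)) (id_funct A)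
    (\<lambda>X\<in>obs A. cmp A (\<eta> X) (on_arrs F (\<epsilon> (on_obs G X))))"
proof -
  interpret F: additive_functor B A F by fact
  interpret G: additive_functor A B G by fact
  interpret U: additive_functor C B U by fact
  interpret V: additive_functor B C V by fact
  note FH = additive_functor_Hom[OF F] and GH = additive_functor_Hom[OF G]
    and UH = additive_functor_Hom[OF U] and VH = additive_functor_Hom[OF V]
  have HA: "f \<in> arrs A" "X \<in> obs A" "Y \<in> obs A" if "f \<in> Hom A X Y" for f X Y
    using Hom_obs[OF F.T.category_axioms that] by auto
  have HB: "f \<in> arrs B" if "f \<in> Hom B X Y" for f X Y
    using Hom_obs[OF F.S.category_axioms that] by auto
  have HC: "f \<in> arrs C" if "f \<in> Hom C X Y" for f X Y
    using Hom_obs[OF U.S.category_axioms that] by auto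
  let ?FG = "\<lambda>X. on_obs F (on_obs G X)" and ?UV = "\<lambda>X. on_obs U (on_obs V X)"
  have e1: "\<eta> X \<in> Hom A (?FG X) X" if "X \<in> obs A" for X
    using \<eta> that by (fastforce simp: nat_trans_def comp_funct_def compose_def id_funct_def)
  have e2: "\<epsilon> Y \<in> Hom B (?UV Y) Y" if "Y \<in> obs B" for Y
    using \<epsilon> that by (fastforce simp: nat_trans_def comp_funct_def compose_def id_funct_def)
  have n1: "cmp A (\<eta> Y) (on_arrs F (on_arrs G f)) = cmp A f (\<eta> X)" if "f \<in> Hom A X Y" for f X Y
    using \<eta> that HA[OF that] by (fastforce simp: nat_trans_def comp_funct_def compose_def id_funct_def)
  have n2: "cmp B (\<epsilon> Y) (on_arrs U (on_arrs V f)) = cmp B f (\<epsilon> X)" if "f \<in> Hom B X Y" for f X Y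
    using \<epsilon> that HB[OF that] by (fastforce simp: nat_trans_def comp_funct_def compose_def id_funct_def)
  have Fe: "on_arrs F (\<epsilon> (on_obs G X)) \<in> Hom A (on_obs F (?UV (on_obs G X))) (?FG X)"
    if "X \<in> obs A" for X
    using FH[OF e2[OF G.on_obs_in[OF that]]] .
  have ty: "cmp A (\<eta> X) (on_arrs F (\<epsilon> (on_obs G X))) \<in> Hom A (on_obs F (?UV (on_obs G X))) X"
    if "X \<in> obs A" for X
    using F.T.comp_in[OF Fe[OF that] e1[OF that]] .
  have nat: "cmp A (cmp A (\<eta> Y) (on_arrs F (\<epsilon> (on_obs G Y))))
        (on_arrs F (on_arrs U (on_arrs V (on_arrs G f)))) =
      cmp A f (cmp A (\<eta> X) (on_arrs F (\<epsilon> (on_obs G X))))" if f: "f \<in> Hom A X Y" for f X Y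
  proof -
    have X: "X \<in> obs A" and Y: "Y \<in> obs A" using HA[OF f] by auto
    note Gf = GH[OF f]
    note uv = UH[OF VH[OF Gf]]
    have "cmp A (cmp A (\<eta> Y) (on_arrs F (\<epsilon> (on_obs G Y))))
        (on_arrs F (on_arrs U (on_arrs V (on_arrs G f)))) =
      cmp A (\<eta> Y) (cmp A (on_arrs F (\<epsilon> (on_obs G Y)))
        (on_arrs F (on_arrs U (on_arrs V (on_arrs G f)))))"
      using F.T.comp_assoc[OF FH[OF uv] Fe[OF Y] e1[OF Y]] by simp
    also have "\<dots> = cmp A (\<eta> Y) (on_arrs F (cmp B (on_arrs G f) (\<epsilon> (on_obs G X))))"
      using F.on_arrs_comp[OF uv e2[OF G.on_obs_in[OF Y]]] n2[OF Gf] by simp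
    also have "\<dots> = cmp A (\<eta> Y) (cmp A (on_arrs F (on_arrs G f)) (on_arrs F (\<epsilon> (on_obs G X))))"
      using F.on_arrs_comp[OF e2[OF G.on_obs_in[OF X]] Gf] by simp
    also have "\<dots> = cmp A (cmp A f (\<eta> X)) (on_arrs F (\<epsilon> (on_obs G X)))"
      using F.T.comp_assoc[OF Fe[OF X] FH[OF Gf] e1[OF Y]] n1[OF f] by simp
    also have "\<dots> = cmp A f (cmp A (\<eta> X) (on_arrs F (\<epsilon> (on_obs G X))))"
      using F.T.comp_assoc[OF Fe[OF X] e1[OF X] f] by simp
    finally show ?thesis .
  qed
  show ?thesis
    unfolding nat_trans_def
  proof (intro conjI ballI allI)
    fix X assume X: "X \<in> obs A"
    then show "(\<lambda>X\<in>obs A. cmp A (\<eta> X) (on_arrs F (\<epsilon> (on_obs G X)))) X \<in>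
      Hom A (on_obs (comp_funct A (comp_funct C F U) (comp_funct A V G)) X) (on_obs (id_funct A) X)"
      using ty[OF X] G.on_obs_in[OF X] V.on_obs_in
      by (simp add: comp_funct_def compose_def id_funct_def)
  next
    fix X Y f assume f: "f \<in> Hom A X Y"
    show "cmp A ((\<lambda>X\<in>obs A. cmp A (\<eta> X) (on_arrs F (\<epsilon> (on_obs G X)))) Y)
        (on_arrs (comp_funct A (comp_funct C F U) (comp_funct A V G)) f) =
      cmp A (on_arrs (id_funct A) f)
        ((\<lambda>X\<in>obs A. cmp A (\<eta> X) (on_arrs F (\<epsilon> (on_obs G X)))) X)"
      using nat[OF f] HA[OF f] HC[OF VH[OF GH[OF f]]]
      by (simp add: comp_funct_def compose_def id_funct_def)
  qed simp
qed

lemma comp_ctx_right_wide_morita_context: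
  assumes "right_wide_morita_context A B \<Gamma>" "right_wide_morita_context B C \<Delta>"
  shows "right_wide_morita_context A C (comp_ctx A C \<Gamma> \<Delta>)"
proof -
  interpret \<Gamma>: right_wide_morita_context A B \<Gamma> by fact
  interpret \<Delta>: right_wide_morita_context B C \<Delta> by fact
  define F G \<eta> \<rho> U V \<epsilon> \<delta> where defs: "F = ctx_F \<Gamma>" "G = ctx_G \<Gamma>" "\<eta> = ctx_eta \<Gamma>" "\<rho> = ctx_rho \<Gamma>"
    "U = ctx_F \<Delta>" "V = ctx_G \<Delta>" "\<epsilon> = ctx_eta \<Delta>" "\<delta> = ctx_rho \<Delta>"
  note folds = defs[symmetric]
  interpret F: right_exact_functor B A F using \<Gamma>.F_right_exact by (simp add: folds)
  interpret G: right_exact_functor A B G using \<Gamma>.G_right_exact by (simp add: folds)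
  interpret U: right_exact_functor C B U using \<Delta>.F_right_exact by (simp add: folds)
  interpret V: right_exact_functor B C V using \<Delta>.G_right_exact by (simp add: folds)
  note FH = additive_functor_Hom[OF F.additive_functor_axioms]
    and GH = additive_functor_Hom[OF G.additive_functor_axioms]
    and UH = additive_functor_Hom[OF U.additive_functor_axioms]
    and VH = additive_functor_Hom[OF V.additive_functor_axioms]
  note HA = Hom_obs[OF \<Gamma>.A.category_axioms] and HC = Hom_obs[OF \<Delta>.B.category_axioms]
  have eta: "\<eta> X \<in> Hom A (on_obs F (on_obs G X)) X" if "X \<in> obs A" for X
    using \<Gamma>.eta_nat that by (fastforce simp: folds nat_trans_def comp_funct_def compose_def id_funct_def)
  have rho: "\<rho> Y \<in> Hom B (on_obs G (on_obs F Y)) Y" if "Y \<in> obs B" for Y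
    using \<Gamma>.rho_nat that by (fastforce simp: folds nat_trans_def comp_funct_def compose_def id_funct_def)
  have eps: "\<epsilon> Y \<in> Hom B (on_obs U (on_obs V Y)) Y" if "Y \<in> obs B" for Y
    using \<Delta>.eta_nat that by (fastforce simp: folds nat_trans_def comp_funct_def compose_def id_funct_def)
  have del: "\<delta> Z \<in> Hom C (on_obs V (on_obs U Z)) Z" if "Z \<in> obs C" for Z
    using \<Delta>.rho_nat that by (fastforce simp: folds nat_trans_def comp_funct_def compose_def id_funct_def)
  have rnat: "cmp B (\<rho> Y) (on_arrs G (on_arrs F f)) = cmp B f (\<rho> X)" if "f \<in> Hom B X Y" for f X Y
    using \<Gamma>.rho_nat that Hom_obs[OF \<Gamma>.B.category_axioms that]
    by (fastforce simp: folds nat_trans_def comp_funct_def compose_def id_funct_def)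
  have enat: "cmp B (\<epsilon> Y) (on_arrs U (on_arrs V f)) = cmp B f (\<epsilon> X)" if "f \<in> Hom B X Y" for f X Y
    using \<Delta>.eta_nat that Hom_obs[OF \<Gamma>.B.category_axioms that]
    by (fastforce simp: folds nat_trans_def comp_funct_def compose_def id_funct_def)
  have Ge: "on_arrs G (\<eta> X) = \<rho> (on_obs G X)" if "X \<in> obs A" for X
    using \<Gamma>.G_eta[OF that] by (simp add: folds)
  have Fr: "on_arrs F (\<rho> Y) = \<eta> (on_obs F Y)" if "Y \<in> obs B" for Y
    using \<Gamma>.F_rho[OF that] by (simp add: folds)
  have Ve: "on_arrs V (\<epsilon> Y) = \<delta> (on_obs V Y)" if "Y \<in> obs B" for Y
    using \<Delta>.G_eta[OF that] by (simp add: folds)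
  have Ud: "on_arrs U (\<delta> Z) = \<epsilon> (on_obs U Z)" if "Z \<in> obs C" for Z
    using \<Delta>.F_rho[OF that] by (simp add: folds)
  show ?thesis
  proof (intro right_wide_morita_context.intro right_wide_morita_context_axioms.intro)
    show "abelian_category A" "abelian_category C" by unfold_locales
    show "right_exact_functor C A (ctx_F (comp_ctx A C \<Gamma> \<Delta>))"
      by (simp add: comp_ctx_def right_exact_comp_funct[OF \<Delta>.F_right_exact \<Gamma>.F_right_exact])
    show "right_exact_functor A C (ctx_G (comp_ctx A C \<Gamma> \<Delta>))"
      by (simp add: comp_ctx_def right_exact_comp_funct[OF \<Gamma>.G_right_exact \<Delta>.G_right_exact])
    show "nat_trans A A (comp_funct A (ctx_F (comp_ctx A C \<Gamma> \<Delta>)) (ctx_G (comp_ctx A C \<Gamma> \<Delta>)))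
        (id_funct A) (ctx_eta (comp_ctx A C \<Gamma> \<Delta>))"
      using nat_trans_sandwich[OF F.additive_functor_axioms G.additive_functor_axioms
          U.additive_functor_axioms V.additive_functor_axioms, of \<eta> \<epsilon>] \<Gamma>.eta_nat \<Delta>.eta_nat
      by (simp add: comp_ctx_def folds)
    show "nat_trans C C (comp_funct C (ctx_G (comp_ctx A C \<Gamma> \<Delta>)) (ctx_F (comp_ctx A C \<Gamma> \<Delta>)))
        (id_funct C) (ctx_rho (comp_ctx A C \<Gamma> \<Delta>))"
      using nat_trans_sandwich[OF V.additive_functor_axioms U.additive_functor_axioms
          G.additive_functor_axioms F.additive_functor_axioms, of \<delta> \<rho>] \<Gamma>.rho_nat \<Delta>.rho_nat
      by (simp add: comp_ctx_def folds)
  next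
    fix X assume X: "X \<in> obs A"
    let ?Y = "on_obs G X"
    have Y: "?Y \<in> obs B" by (rule G.on_obs_in[OF X])
    note Z = V.on_obs_in[OF Y]
    note t = FH[OF eps[OF Y]]
    have c: "cmp A (\<eta> X) (on_arrs F (\<epsilon> ?Y)) \<in> Hom A (on_obs F (on_obs U (on_obs V ?Y))) X"
      using \<Gamma>.A.comp_in[OF t eta[OF X]] .
    have "on_arrs V (on_arrs G (cmp A (\<eta> X) (on_arrs F (\<epsilon> ?Y)))) =
        on_arrs V (cmp B (\<rho> ?Y) (on_arrs G (on_arrs F (\<epsilon> ?Y))))"
      by (simp add: G.on_arrs_comp[OF t eta[OF X]] Ge[OF X])
    also have "\<dots> = on_arrs V (cmp B (\<epsilon> ?Y) (\<rho> (on_obs U (on_obs V ?Y))))"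
      by (simp add: rnat[OF eps[OF Y]])
    also have "\<dots> = cmp C (\<delta> (on_obs V ?Y)) (on_arrs V (\<rho> (on_obs U (on_obs V ?Y))))"
      by (simp add: V.on_arrs_comp[OF rho[OF U.on_obs_in[OF Z]] eps[OF Y]] Ve[OF Y])
    finally show "on_arrs (ctx_G (comp_ctx A C \<Gamma> \<Delta>)) (ctx_eta (comp_ctx A C \<Gamma> \<Delta>) X) =
        ctx_rho (comp_ctx A C \<Gamma> \<Delta>) (on_obs (ctx_G (comp_ctx A C \<Gamma> \<Delta>)) X)"
      using X Z HA(3)[OF c] by (simp add: comp_ctx_def folds comp_funct_def compose_def)
  next
    fix Z assume Z: "Z \<in> obs C"
    let ?Y = "on_obs U Z"
    have Y: "?Y \<in> obs B" by (rule U.on_obs_in[OF Z])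
    note X = F.on_obs_in[OF Y]
    note t = VH[OF rho[OF Y]]
    have c: "cmp C (\<delta> Z) (on_arrs V (\<rho> ?Y)) \<in> Hom C (on_obs V (on_obs G (on_obs F ?Y))) Z"
      using \<Delta>.B.comp_in[OF t del[OF Z]] .
    have "on_arrs F (on_arrs U (cmp C (\<delta> Z) (on_arrs V (\<rho> ?Y)))) =
        on_arrs F (cmp B (\<epsilon> ?Y) (on_arrs U (on_arrs V (\<rho> ?Y))))"
      by (simp add: U.on_arrs_comp[OF t del[OF Z]] Ud[OF Z])
    also have "\<dots> = on_arrs F (cmp B (\<rho> ?Y) (\<epsilon> (on_obs G (on_obs F ?Y))))"
      by (simp add: enat[OF rho[OF Y]])
    also have "\<dots> = cmp A (\<eta> (on_obs F ?Y)) (on_arrs F (\<epsilon> (on_obs G (on_obs F ?Y))))"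
      by (simp add: F.on_arrs_comp[OF eps[OF G.on_obs_in[OF X]] rho[OF Y]] Fr[OF Y])
    finally show "on_arrs (ctx_F (comp_ctx A C \<Gamma> \<Delta>)) (ctx_rho (comp_ctx A C \<Gamma> \<Delta>) Z) =
        ctx_eta (comp_ctx A C \<Gamma> \<Delta>) (on_obs (ctx_F (comp_ctx A C \<Gamma> \<Delta>)) Z)"
      using Z X HC(3)[OF c] by (simp add: comp_ctx_def folds comp_funct_def compose_def)
  qed
qed

end

theory Submission imports Defs begin

text \<open>Composition of functors is strictly associative, so only the transformations need an
  argument. For \<open>\<Gamma> = (F, G, \<eta>, \<rho>)\<close>, \<open>\<Delta> = (U, V, \<epsilon>, \<delta>)\<close> and \<open>\<kappa>\<close> the first transformation of \<open>\<Sigma>\<close>,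
  the first transformations of the two composites at \<open>X\<close> are
  \<open>(\<eta>(X) \<circ> F(\<epsilon>(G X))) \<circ> F(U(\<kappa>(V G X)))\<close> and \<open>\<eta>(X) \<circ> F(\<epsilon>(G X) \<circ> U(\<kappa>(V G X)))\<close>, which agree by
  functoriality of \<open>F\<close> and associativity. The second transformations are the same statement with
  the order of the contexts reversed.\<close>

lemma additive_functor_arrs:
  assumes "additive_functor S T F"
  shows "on_arrs F \<in> arrs S \<rightarrow> arrs T"
  using additive_functor_Hom[OF assms] by (fastforce simp: Hom_def)

text \<open>Composites are restricted to carriers; as \<open>H\<close> maps those of
  \<open>R\<close> into those of \<open>S\<close>, the inner restriction is invisible.\<close>

lemma comp_funct_assoc:
  assumes "additive_functor R S H"
  shows "comp_funct R (comp_funct S K L) H = comp_funct R K (comp_funct R L H)"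
proof -
  interpret additive_functor R S H by fact
  have "on_obs H \<in> obs R \<rightarrow> obs S"
    by (simp add: on_obs_in)
  then show ?thesis
    using additive_functor_arrs[OF assms] by (simp add: comp_funct_def compose_assoc)
qed

lemma nat_trans_counit_in:
  assumes "nat_trans S S (comp_funct S F G) (id_funct S) \<alpha>" "X \<in> obs S"
  shows "\<alpha> X \<in> Hom S (on_obs F (on_obs G X)) X"
  using assms by (fastforce simp: nat_trans_def comp_funct_def compose_def id_funct_def)

lemma sandwich_assoc:
  assumes F: "additive_functor B A F" and G: "additive_functor A B G"
    and U: "additive_functor C B U" and V: "additive_functor B C V"
    and \<eta>: "nat_trans A A (comp_funct A F G) (id_funct A) \<eta>"
    and \<epsilon>: "nat_trans B B (comp_funct B U V) (id_funct B) \<epsilon>"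
    and \<kappa>: "nat_trans C C (comp_funct C K L) (id_funct C) \<kappa>"
    and X: "X \<in> obs A"
  shows "cmp A (cmp A (\<eta> X) (on_arrs F (\<epsilon> (on_obs G X))))
      (on_arrs (comp_funct C F U) (\<kappa> (on_obs (comp_funct A V G) X))) =
    cmp A (\<eta> X) (on_arrs F (cmp B (\<epsilon> (on_obs G X)) (on_arrs U (\<kappa> (on_obs V (on_obs G X))))))"
proof -
  interpret F: additive_functor B A F by fact
  interpret G: additive_functor A B G by fact
  interpret V: additive_functor B C V by fact
  let ?Y = "on_obs G X"
  have Y: "?Y \<in> obs B" by (rule G.on_obs_in[OF X])
  note k = nat_trans_counit_in[OF \<kappa> V.on_obs_in[OF Y]]
  note e = nat_trans_counit_in[OF \<epsilon> Y]
  note Uk = additive_functor_Hom[OF U k]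
  \<comment> \<open>This lets the restricted \<open>comp_funct C F U\<close> unfold at this
    arrow.\<close>
  have "\<kappa> (on_obs V ?Y) \<in> arrs C" using k by (simp add: Hom_def)
  then show ?thesis
    using X by (simp add: comp_funct_def compose_def F.on_arrs_comp[OF Uk e]
        F.T.comp_assoc[OF additive_functor_Hom[OF F Uk] additive_functor_Hom[OF F e]
          nat_trans_counit_in[OF \<eta> X]])
qed

theorem proposition2p6:
  fixes A :: "('oa, 'ma) cat" and B :: "('ob, 'mb) cat"
    and C :: "('oc, 'mc) cat" and D :: "('od, 'md) cat"
    and \<Gamma> :: "('oa, 'ma, 'ob, 'mb) wide_context"
    and \<Delta> :: "('ob, 'mb, 'oc, 'mc) wide_context"
    and \<Sigma> :: "('oc, 'mc, 'od, 'md) wide_context"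
  assumes "abelian_category A" and "abelian_category B"
    and "abelian_category C" and "abelian_category D"
    and "right_wide_morita_context A B \<Gamma>"
    and "right_wide_morita_context B C \<Delta>"
    and "right_wide_morita_context C D \<Sigma>"
  shows "comp_ctx A D (comp_ctx A C \<Gamma> \<Delta>) \<Sigma> = comp_ctx A D \<Gamma> (comp_ctx B D \<Delta> \<Sigma>)"
proof -
  interpret \<Gamma>: right_wide_morita_context A B \<Gamma> by fact
  interpret \<Delta>: right_wide_morita_context B C \<Delta> by fact
  interpret \<Sigma>: right_wide_morita_context C D \<Sigma> by fact
  interpret F: right_exact_functor B A "ctx_F \<Gamma>" by (rule \<Gamma>.F_right_exact)
  interpret G: right_exact_functor A B "ctx_G \<Gamma>" by (rule \<Gamma>.G_right_exact)
  interpret U: right_exact_functor C B "ctx_F \<Delta>" by (rule \<Delta>.F_right_exact)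
  interpret V: right_exact_functor B C "ctx_G \<Delta>" by (rule \<Delta>.G_right_exact)
  interpret K: right_exact_functor D C "ctx_F \<Sigma>" by (rule \<Sigma>.F_right_exact)
  interpret L: right_exact_functor C D "ctx_G \<Sigma>" by (rule \<Sigma>.G_right_exact)
  note eta = sandwich_assoc[OF F.additive_functor_axioms G.additive_functor_axioms
      U.additive_functor_axioms V.additive_functor_axioms \<Gamma>.eta_nat \<Delta>.eta_nat \<Sigma>.eta_nat]
  \<comment> \<open>Under the reversal, the left side of this instance belongs to \<Gamma> \<circ>
    (\<Delta> \<circ> \<Sigma>), whereas that of \<open>eta\<close> belongs to (\<Gamma> \<circ>
    \<Delta>) \<circ> \<Sigma>.\<close>
  note rho = sandwich_assoc[OF L.additive_functor_axioms K.additive_functor_axioms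
      V.additive_functor_axioms U.additive_functor_axioms \<Sigma>.rho_nat \<Delta>.rho_nat \<Gamma>.rho_nat]
  show ?thesis
    unfolding comp_ctx_def
    using comp_funct_assoc[OF K.additive_functor_axioms, of "ctx_F \<Gamma>" "ctx_F \<Delta>"]
      comp_funct_assoc[OF G.additive_functor_axioms, of "ctx_G \<Sigma>" "ctx_G \<Delta>"]
    \<comment> \<open>The inner composites' transformations, restricted to \<open>obs B\<close> and
      \<open>obs C\<close>, are evaluated at images under \<open>ctx_G \<Gamma>\<close> and
      \<open>ctx_F \<Sigma>\<close>.\<close>
    by (auto simp: eta rho G.on_obs_in K.on_obs_in intro!: restrict_ext)
qed

end
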